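(* Algorithm \textsf{A} (defined below), run on an undirected graph with vertex set $[n]$, takes $O(d)$ steps, where $d$ is the maximum of the diameters of the connected components of the input graph.
   Context: Each edge $e$ has two ends $e.v,e.w$; the current edge set is initially the input edge set. Each vertex $v$ has a parent $v.p$, initially $v$. Vertices are compared as integers. Each operation is performed simultaneously for all edges/vertices using values at the start of the operation. \textsc{connect}: for each current edge $e$, send $\min\{e.v,e.w\}$ to $\max\{e.v,e.w\}$. \textsc{update}: for each vertex $v$, replace $v.p$ by the minimum of $v.p$ and the vertices sent to $v$ in the preceding \textsc{connect}. \textsc{shortcut}: for each vertex $v$, replace $v.p$ by $(v.p).p$. \textsc{alter}: for each edge $e$, let $x=e.v.p$, $y=e.w.p$; if $x=y$ delete $e$, else replace $e.v,e.w$ by $x,y$. Algorithm \textsf{A}: repeat \{\textsc{connect}; \textsc{update}; \textsc{shortcut}; \textsc{alter}\} until no parent changes. Each iteration is a round; a round consists of a constant number of synchronous concurrent message-passing steps, so the number of steps is within a constant factor of the number of rounds. *)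

theory Defs
  imports Main
begin

text \<open>
  Edges are objects with an identity (a natural number) and two mutable ends, so that edges made
  parallel by \<open>alter\<close> stay distinct. The order of the two ends carries no meaning;
  input graphs may have loops and parallel edges.
\<close>

record graph =
  edges :: "nat set"
  end_v :: "nat \<Rightarrow> nat"
  end_w :: "nat \<Rightarrow> nat"

definition graph_on :: "nat \<Rightarrow> graph \<Rightarrow> bool" where
  "graph_on n G \<longleftrightarrow>
     finite (edges G) \<and> (\<forall>e \<in> edges G. end_v G e \<in> {1..n} \<and> end_w G e \<in> {1..n})"

definition adjacent :: "graph \<Rightarrow> nat \<Rightarrow> nat \<Rightarrow> bool" where
  "adjacent G x y \<longleftrightarrow> (\<exists>e \<in> edges G. {end_v G e, end_w G e} = {x, y})"

definition components :: "nat \<Rightarrow> graph \<Rightarrow> nat set set" where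
  "components n G = {1..n} // {(x, y). x \<in> {1..n} \<and> y \<in> {1..n} \<and> (adjacent G)\<^sup>*\<^sup>* x y}"

text \<open>Only meaningful for \<open>x\<close> and \<open>y\<close> in the same component.\<close>

definition distance :: "graph \<Rightarrow> nat \<Rightarrow> nat \<Rightarrow> nat" where
  "distance G x y = (LEAST k. (adjacent G ^^ k) x y)"

definition diameter :: "graph \<Rightarrow> nat set \<Rightarrow> nat" where
  "diameter G K = Max {distance G x y | x y. x \<in> K \<and> y \<in> K}"

definition max_diameter :: "nat \<Rightarrow> graph \<Rightarrow> nat" where
  "max_diameter n G = Max (diameter G ` components n G)"

record state = graph +
  parent :: "nat \<Rightarrow> nat"

definition initial :: "graph \<Rightarrow> state" where
  "initial G = graph.extend G \<lparr>parent = (\<lambda>v. v)\<rparr>"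

text \<open>\<open>connect s v\<close> is the set of vertices sent to \<open>v\<close>.\<close>

definition connect :: "state \<Rightarrow> nat \<Rightarrow> nat set" where
  "connect s v =
     {min (end_v s e) (end_w s e) | e. e \<in> edges s \<and> max (end_v s e) (end_w s e) = v}"

definition update :: "(nat \<Rightarrow> nat set) \<Rightarrow> state \<Rightarrow> state" where
  "update sent s = s\<lparr>parent := (\<lambda>v. Min (insert (parent s v) (sent v)))\<rparr>"

definition shortcut :: "state \<Rightarrow> state" where
  "shortcut s = s\<lparr>parent := (\<lambda>v. parent s (parent s v))\<rparr>"

definition alter :: "state \<Rightarrow> state" where
  "alter s = s\<lparr>
     edges := {e \<in> edges s. parent s (end_v s e) \<noteq> parent s (end_w s e)},
     end_v := (\<lambda>e. parent s (end_v s e)),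
     end_w := (\<lambda>e. parent s (end_w s e))\<rparr>"

definition round_A :: "state \<Rightarrow> state" where
  "round_A s = alter (shortcut (update (connect s) s))"

definition parents_unchanged :: "nat \<Rightarrow> state \<Rightarrow> state \<Rightarrow> bool" where
  "parents_unchanged n s s' \<longleftrightarrow> (\<forall>v \<in> {1..n}. parent s' v = parent s v)"

text \<open>
  \<open>loop_steps c n s t\<close>: the loop on vertex set \<open>{1..n}\<close>, entered in state \<open>s\<close>, terminates after
  exactly \<open>t\<close> steps, where every round, including the final one that changes no parent,
  consists of \<open>c\<close> steps.
\<close>

inductive loop_steps :: "nat \<Rightarrow> nat \<Rightarrow> state \<Rightarrow> nat \<Rightarrow> bool" for c n :: nat where
  stop: "parents_unchanged n s (round_A s) \<Longrightarrow> loop_steps c n s c"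
| again: "\<not> parents_unchanged n s (round_A s) \<Longrightarrow> loop_steps c n (round_A s) t \<Longrightarrow>
    loop_steps c n s (c + t)"

definition algorithm_A_steps :: "nat \<Rightarrow> nat \<Rightarrow> graph \<Rightarrow> nat \<Rightarrow> bool" where
  "algorithm_A_steps c n G t \<longleftrightarrow> loop_steps c n (initial G) t"

lemma loop_steps_unique: "loop_steps c n s t \<Longrightarrow> loop_steps c n s t' \<Longrightarrow> t = t'"
proof (induction arbitrary: t' rule: loop_steps.induct)
  case (stop s)
  from stop(2) show ?case by cases (use stop(1) in auto)
next
  case (again s t)
  from again(4) show ?case by cases (use again(1,3) in auto)
qed

end

theory Submission
  imports Defs
begin

text \<open>
  Let \<open>L\<^sub>k a\<close> be the vertex that replaces \<open>a\<close> as an edge end after \<open>k\<close> rounds. If \<open>L\<^sub>k a\<close> is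
  already the minimum \<open>u\<close> of the component of \<open>a\<close> and \<open>b\<close> is a neighbour of \<open>a\<close>, then the altered
  edge sends \<open>u\<close> to \<open>L\<^sub>k b\<close>, whence \<open>L\<^bsub>k+1\<^esub> b = u\<close>. So after \<open>d\<close> rounds every \<open>L\<^sub>d a\<close> is a
  component minimum. It remains to bound the depth of the parent trees: the range of \<open>L\<^sub>k\<close> is closed
  under taking parents, and the grandparent of every vertex lies in it, which is preserved because
  vertices sent by \<open>connect\<close> lie in this range and shortcutting halves the way to it. Hence after \<open>d\<close>
  rounds all grandparents are component minima, one more round makes all parents component minima,
  and the next one changes nothing.
\<close>

section \<open>Component minima\<close>

definition comp_min :: "graph \<Rightarrow> nat \<Rightarrow> nat" where
  "comp_min G v = (LEAST w. (adjacent G)\<^sup>*\<^sup>* v w)"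

lemma adjacent_sym: "adjacent G x y \<Longrightarrow> adjacent G y x"
  by (simp add: adjacent_def insert_commute)

lemma rtranclp_adjacent_sym: "(adjacent G)\<^sup>*\<^sup>* x y \<Longrightarrow> (adjacent G)\<^sup>*\<^sup>* y x"
  by (metis adjacent_sym symp_def symp_rtranclp)

lemma comp_min_reachable: "(adjacent G)\<^sup>*\<^sup>* v (comp_min G v)"
  unfolding comp_min_def by (rule LeastI[of _ v]) simp

lemma comp_min_le: "comp_min G v \<le> v"
  unfolding comp_min_def by (rule Least_le) simp

lemma comp_min_cong:
  assumes "(adjacent G)\<^sup>*\<^sup>* x y"
  shows "comp_min G x = comp_min G y"
proof -
  have "(adjacent G)\<^sup>*\<^sup>* x w \<longleftrightarrow> (adjacent G)\<^sup>*\<^sup>* y w" for w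
    using assms rtranclp_adjacent_sym rtranclp_trans by metis
  then show ?thesis by (simp add: comp_min_def)
qed

lemma comp_min_idem [simp]: "comp_min G (comp_min G v) = comp_min G v"
  using comp_min_cong[OF comp_min_reachable] by simp

lemma comp_min_edge:
  assumes "e \<in> edges G"
  shows "comp_min G (end_v G e) = comp_min G (end_w G e)"
  using assms by (intro comp_min_cong r_into_rtranclp) (auto simp: adjacent_def)

section \<open>One round and its invariants\<close>

definition updated_parent :: "state \<Rightarrow> nat \<Rightarrow> nat" where
  "updated_parent s v = Min (insert (parent s v) (connect s v))"

lemma round_A_sel:
  "parent (round_A s) v = updated_parent s (updated_parent s v)"
  "edges (round_A s) = {e \<in> edges s. parent (round_A s) (end_v s e) \<noteq> parent (round_A s) (end_w s e)}"
  "end_v (round_A s) e = parent (round_A s) (end_v s e)"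
  "end_w (round_A s) e = parent (round_A s) (end_w s e)"
  by (simp_all add: round_A_def alter_def shortcut_def update_def updated_parent_def)

lemma finite_connect: "finite (edges s) \<Longrightarrow> finite (connect s v)"
  by (simp add: connect_def)

text \<open>\<open>alter\<close> moves the ends of deleted edges too, so the end equations can range
  over all edges; by \<open>deleted\<close>, an edge of \<open>G\<close> that was removed survives
  as a loop.\<close>

locale labelled_state =
  fixes G :: graph and s :: state and L :: "nat \<Rightarrow> nat"
  assumes fin: "finite (edges s)"
    and sub: "edges s \<subseteq> edges G"
    and end_v: "\<And>e. end_v s e = L (end_v G e)"
    and end_w: "\<And>e. end_w s e = L (end_w G e)"
    and deleted: "\<And>e. e \<in> edges G \<Longrightarrow> e \<notin> edges s \<Longrightarrow> end_v s e = end_w s e"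
    and min_L: "\<And>v. comp_min G (L v) = comp_min G v"
    and min_parent: "\<And>v. comp_min G (parent s v) = comp_min G v"
    and parent_le: "\<And>v. parent s v \<le> v"
    and closed: "\<And>v. v \<in> range L \<Longrightarrow> parent s v \<in> range L"
    and grandparent: "\<And>v. parent s (parent s v) \<in> range L"
begin

abbreviation P where "P \<equiv> updated_parent s"

lemma connectD:
  assumes "x \<in> connect s v"
  shows "x \<in> range L" "comp_min G x = comp_min G v"
proof -
  from assms obtain e where e: "e \<in> edges G"
    and x: "x = min (L (end_v G e)) (L (end_w G e))"
    and v: "v = max (L (end_v G e)) (L (end_w G e))"
    using sub by (auto simp: connect_def end_v end_w)
  show "x \<in> range L" by (simp add: x min_def)
  show "comp_min G x = comp_min G v"
    by (simp add: x v min_def max_def min_L comp_min_edge[OF e])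
qed

lemma P_cases: "P v = parent s v \<or> P v \<in> connect s v"
  using Min_in[of "insert (parent s v) (connect s v)"] finite_connect[OF fin]
  by (auto simp: updated_parent_def)

lemma P_le_parent: "P v \<le> parent s v"
  using finite_connect[OF fin] by (simp add: updated_parent_def)

lemma P_le_sent: "x \<in> connect s v \<Longrightarrow> P v \<le> x"
  using finite_connect[OF fin] by (simp add: updated_parent_def)

lemma P_le: "P v \<le> v"
  using P_le_parent parent_le le_trans by blast

lemma min_P: "comp_min G (P v) = comp_min G v"
  using P_cases connectD(2) min_parent by metis

lemma P_closed: "v \<in> range L \<Longrightarrow> P v \<in> range L"
  using P_cases connectD(1) closed by metis

text \<open>If \<open>P v\<close> was sent, it is a label and \<open>P_closed\<close> applies.
  Otherwise it is the old parent, and \<open>P\<close> of that is either the old grandparent or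
  again a sent vertex.\<close>

lemma P_P_range: "P (P v) \<in> range L"
  using P_cases connectD(1) P_closed grandparent by metis

text \<open>\<open>P\<close> neither increases a vertex nor leaves its component.\<close>

lemma P_comp_min: "P (comp_min G v) = comp_min G v"
  by (metis P_le antisym comp_min_idem comp_min_le min_P)

lemma P_eq_comp_min:
  assumes "P v \<le> comp_min G v"
  shows "P v = comp_min G v"
  using assms by (metis antisym comp_min_le min_P)

lemma labelled_state_round_A: "labelled_state G (round_A s) (\<lambda>v. parent (round_A s) (L v))"
proof
  let ?Q = "parent (round_A s)"
  have Q: "?Q v = P (P v)" for v by (rule round_A_sel)
  show "finite (edges (round_A s))" using fin by (simp add: round_A_sel(2))
  show "edges (round_A s) \<subseteq> edges G" using sub by (auto simp: round_A_sel(2))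
  show "end_v (round_A s) e = ?Q (L (end_v G e))"
    "end_w (round_A s) e = ?Q (L (end_w G e))" for e
    by (simp_all add: round_A_sel(3,4) end_v end_w)
  show "end_v (round_A s) e = end_w (round_A s) e"
    if "e \<in> edges G" "e \<notin> edges (round_A s)" for e
    using that deleted[of e] by (auto simp: round_A_sel(2-4))
  show "comp_min G (?Q (L v)) = comp_min G v" "comp_min G (?Q v) = comp_min G v" for v
    by (simp_all add: Q min_P min_L)
  show "?Q v \<le> v" for v unfolding Q using P_le le_trans by blast
  \<comment> \<open>Both closure goals below reduce to this: \<open>P (P x)\<close> is needed for an
    \<open>x\<close> that is an old label by \<open>P_closed\<close> or
    \<open>P_P_range\<close>.\<close>
  have in_range: "P (P x) \<in> range (\<lambda>v. ?Q (L v))" if "x \<in> range L" for x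
    using that by (auto simp: Q)
  show "?Q v \<in> range (\<lambda>v. ?Q (L v))" if "v \<in> range (\<lambda>v. ?Q (L v))" for v
    using that P_closed in_range by (auto simp: Q)
  show "?Q (?Q v) \<in> range (\<lambda>v. ?Q (L v))" for v
    unfolding Q by (rule in_range[OF P_P_range, unfolded Q])
qed

lemma label_neighbour:
  assumes "adjacent G a b" "L a = comp_min G a"
  shows "parent (round_A s) (L b) = comp_min G b"
proof -
  have ab: "comp_min G a = comp_min G b"
    using assms(1) by (intro comp_min_cong) simp
  from assms(1) obtain e where e: "e \<in> edges G" "{end_v G e, end_w G e} = {a, b}"
    by (auto simp: adjacent_def)
  have ends: "{end_v s e, end_w s e} = {comp_min G b, L b}"
    using e(2) assms(2) ab by (auto simp: end_v end_w doubleton_eq_iff)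
  have "P (L b) = comp_min G b"
  proof (cases "e \<in> edges s")
    case True
    have "comp_min G b \<le> L b" using comp_min_le[of G "L b"] by (simp add: min_L)
    then have "min (end_v s e) (end_w s e) = comp_min G b" "max (end_v s e) (end_w s e) = L b"
      using ends by (auto simp: doubleton_eq_iff)
    then have "comp_min G b \<in> connect s (L b)" using True unfolding connect_def by force
    then show ?thesis using P_le_sent P_eq_comp_min[of "L b"] by (simp add: min_L)
  next
    \<comment> \<open>The ends of a deleted edge coincide, so \<open>L b\<close> is already the
      minimum.\<close>
    case False
    then have "L b = comp_min G b"
      using deleted e(1) ends by (auto simp: doubleton_eq_iff)
    then show ?thesis by (simp add: P_comp_min)
  qed
  then show ?thesis by (simp add: round_A_sel P_comp_min)
qed

lemma label_comp_min_stable: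
  assumes "L a = comp_min G a"
  shows "parent (round_A s) (L a) = comp_min G a"
  by (simp add: assms round_A_sel P_comp_min)

text \<open>Both ends of a current edge are now the same component minimum, so vertices are sent
  only to themselves and \<open>update\<close> changes nothing. \<open>shortcut\<close> then
  installs the grandparents, which are labels.\<close>

lemma round_A_parent_if_labels_minimal:
  assumes "\<And>v. L v = comp_min G v"
  shows "parent (round_A s) v = comp_min G v"
proof -
  have "x = v" if "x \<in> connect s v" for x v
    using that sub comp_min_edge by (auto simp: connect_def end_v end_w assms subset_iff)
  then have P: "P v = parent s v" for v
    using P_cases P_le_parent parent_le antisym by metis
  \<comment> \<open>As a label, the grandparent is the minimum of some component;
    \<open>min_parent\<close> shows that it is the component of \<open>v\<close>.\<close>
  obtain w where "parent s (parent s v) = comp_min G w"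
    using grandparent[of v] by (auto simp: assms)
  then have "parent s (parent s v) = comp_min G v"
    by (metis comp_min_idem min_parent)
  then show ?thesis by (simp add: round_A_sel P)
qed

end

section \<open>Labels after \<open>k\<close> rounds\<close>

lemma labelled_state_initial:
  assumes "finite (edges G)"
  shows "labelled_state G (initial G) (\<lambda>v. v)"
  using assms by unfold_locales (simp_all add: initial_def graph.extend_def)

text \<open>The index is \<open>Suc k\<close> because \<open>alter\<close> comes last in its round
  and reads the new parents.\<close>

primrec label :: "graph \<Rightarrow> nat \<Rightarrow> nat \<Rightarrow> nat" where
  "label G 0 v = v"
| "label G (Suc k) v = parent ((round_A ^^ Suc k) (initial G)) (label G k v)"

lemma labelled_state_iterate:
  assumes "finite (edges G)"
  shows "labelled_state G ((round_A ^^ k) (initial G)) (label G k)"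
proof (induction k)
  case 0
  have "label G 0 = (\<lambda>v. v)" by auto
  then show ?case using labelled_state_initial[OF assms] by simp
next
  case (Suc k)
  have "label G (Suc k) = (\<lambda>v. parent (round_A ((round_A ^^ k) (initial G))) (label G k v))"
    by auto
  then show ?case using labelled_state.labelled_state_round_A[OF Suc] by simp
qed

text \<open>The induction removes the last edge of a path from the minimum to \<open>v\<close>.
  Allowing \<open>j < k\<close> covers vertices whose label became minimal in an earlier
  round.\<close>

lemma label_eq_comp_min:
  assumes "finite (edges G)" "(adjacent G ^^ j) (comp_min G v) v" "j \<le> k"
  shows "label G k v = comp_min G v"
  using assms(2,3)
proof (induction k arbitrary: j v)
  case 0
  then show ?case by simp
next
  case (Suc k)
  interpret labelled_state G "(round_A ^^ k) (initial G)" "label G k"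
    by (rule labelled_state_iterate[OF assms(1)])
  show ?case
  proof (cases "j \<le> k")
    case True
    then show ?thesis using Suc label_comp_min_stable[of v] by simp
  next
    case False
    with Suc.prems have "j = Suc k" by simp
    with Suc.prems obtain a where a: "(adjacent G ^^ k) (comp_min G v) a" "adjacent G a v"
      by auto
    have "comp_min G a = comp_min G v" using a(2) by (intro comp_min_cong) simp
    then have "label G k a = comp_min G a" using Suc.IH[of k a] a(1) by simp
    then show ?thesis using label_neighbour[OF a(2)] by simp
  qed
qed

section \<open>Distances and the maximum diameter\<close>

lemma rtranclp_adjacent_in:
  assumes "graph_on n G" "(adjacent G)\<^sup>*\<^sup>* x y" "x \<in> {1..n}"
  shows "y \<in> {1..n}"
  using assms(2,3)
proof induction
  case (step y z)
  from \<open>adjacent G y z\<close> assms(1) show ?case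
    by (auto simp: adjacent_def graph_on_def doubleton_eq_iff)
qed

text \<open>\<open>Max\<close> is known to be an upper bound only on finite sets, so most of the
  work is finiteness.\<close>

lemma distance_le_max_diameter:
  assumes "x \<in> {1..n}" "y \<in> {1..n}" "(adjacent G)\<^sup>*\<^sup>* x y"
  shows "distance G x y \<le> max_diameter n G"
proof -
  let ?R = "{(x, y). x \<in> {1..n} \<and> y \<in> {1..n} \<and> (adjacent G)\<^sup>*\<^sup>* x y}"
  let ?K = "?R `` {x}"
  have K: "?K \<in> components n G"
    unfolding components_def using assms(1) by (rule quotientI)
  have "?K \<subseteq> {1..n}" by auto
  then have "finite ?K" by (rule finite_subset) simp
  then have "finite ((\<lambda>(a, b). distance G a b) ` (?K \<times> ?K))" by simp
  also have "(\<lambda>(a, b). distance G a b) ` (?K \<times> ?K) =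
      {distance G a b | a b. a \<in> ?K \<and> b \<in> ?K}"
    by (auto simp: image_iff)
  finally have fin: "finite {distance G a b | a b. a \<in> ?K \<and> b \<in> ?K}" .
  have "x \<in> ?K" "y \<in> ?K" using assms by auto
  then have "distance G x y \<le> diameter G ?K"
    unfolding diameter_def by (intro Max_ge[OF fin]) blast
  moreover have "finite (components n G)"
    unfolding components_def by (rule finite_quotient) auto
  then have "diameter G ?K \<le> max_diameter n G"
    unfolding max_diameter_def using K by (intro Max_ge) auto
  ultimately show ?thesis by simp
qed

lemma label_max_diameter:
  assumes "graph_on n G" "max_diameter n G \<le> k"
  shows "label G k v = comp_min G v"
proof -
  let ?u = "comp_min G v"
  have reach: "(adjacent G)\<^sup>*\<^sup>* ?u v" by (rule rtranclp_adjacent_sym[OF comp_min_reachable])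
  have path: "(adjacent G ^^ distance G ?u v) ?u v"
    using reach unfolding distance_def rtranclp_power by (rule LeastI_ex)
  have "distance G ?u v \<le> k"
  proof (cases "v \<in> {1..n}")
    case True
    then have "?u \<in> {1..n}" using rtranclp_adjacent_in[OF assms(1) comp_min_reachable] by blast
    then show ?thesis using distance_le_max_diameter[OF _ True reach] assms(2) by linarith
  next
    \<comment> \<open>A vertex outside \<open>{1..n}\<close> is isolated, hence its own minimum. For
      \<open>n = 0\<close> only this case occurs, so the unspecified \<open>Max {}\<close> does no
      harm.\<close>
    case False
    then have "\<not> adjacent G v w" for w
      using assms(1) by (auto simp: adjacent_def graph_on_def doubleton_eq_iff)
    then have "v = ?u" using comp_min_reachable[of G v] by (metis converse_rtranclpE)
    then have "distance G ?u v \<le> 0"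
      unfolding distance_def by (intro Least_le) simp
    then show ?thesis by simp
  qed
  then show ?thesis using label_eq_comp_min path assms(1) by (simp add: graph_on_def)
qed

section \<open>Termination and the number of steps\<close>

lemma parents_unchanged_after_max_diameter:
  assumes "graph_on n G"
  defines "s \<equiv> (round_A ^^ Suc (max_diameter n G)) (initial G)"
  shows "parents_unchanged n s (round_A s)"
proof -
  have fin: "finite (edges G)" using assms(1) by (simp add: graph_on_def)
  have "parent (round_A ((round_A ^^ k) (initial G))) v = comp_min G v"
    if "max_diameter n G \<le> k" for k v
    using labelled_state.round_A_parent_if_labels_minimal
      [OF labelled_state_iterate[OF fin] label_max_diameter[OF assms(1) that]] .
  \<comment> \<open>The two instances describe the parents of \<open>s\<close> and of
    \<open>round_A s\<close>.\<close>
  from this[of "max_diameter n G"] this[of "Suc (max_diameter n G)"] show ?thesis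
    by (simp add: parents_unchanged_def s_def)
qed

text \<open>The loop may stop before \<open>m\<close> rounds have passed, hence only a bound;
  \<open>Suc m\<close> includes the final round that changes no parent.\<close>

lemma loop_steps_bound:
  assumes "parents_unchanged n ((round_A ^^ m) s) (round_A ((round_A ^^ m) s))"
  shows "\<exists>t. loop_steps c n s t \<and> t \<le> c * Suc m"
  using assms
proof (induction m arbitrary: s)
  case 0
  then show ?case using loop_steps.stop by fastforce
next
  case (Suc m)
  show ?case
  proof (cases "parents_unchanged n s (round_A s)")
    case True
    then show ?thesis by (intro exI[of _ c]) (simp add: loop_steps.stop)
  next
    case False
    have "\<exists>t. loop_steps c n (round_A s) t \<and> t \<le> c * Suc m"
      using Suc.prems by (intro Suc.IH) (simp add: funpow_swap1)
    then obtain t where "loop_steps c n (round_A s) t" "t \<le> c * Suc m" by blast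
    then show ?thesis
      using loop_steps.again[OF False] by (intro exI[of _ "c + t"]) simp
  qed
qed

theorem theorem12:
  fixes c :: nat
  shows "\<exists>C :: nat. \<forall>(n :: nat) (G :: graph). graph_on n G \<longrightarrow>
           (\<exists>t. algorithm_A_steps c n G t \<and> t \<le> C * max 1 (max_diameter n G))"
proof (rule exI[of _ "c * 3"], intro allI impI)
  fix n and G :: graph assume "graph_on n G"
  from loop_steps_bound[OF parents_unchanged_after_max_diameter[OF this]]
  obtain t where t: "algorithm_A_steps c n G t" "t \<le> c * Suc (Suc (max_diameter n G))"
    unfolding algorithm_A_steps_def by blast
  \<comment> \<open>For \<open>d\<close> the maximum diameter,
    \<open>d + 2 \<le> 3 * max 1 d\<close>, with equality at \<open>d = 1\<close>. The
    \<open>max 1\<close> pays for the rounds run when \<open>d = 0\<close>.\<close>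
  have "c * Suc (Suc (max_diameter n G)) \<le> c * (3 * max 1 (max_diameter n G))"
    by (rule mult_le_mono2) simp
  with t show "\<exists>t. algorithm_A_steps c n G t \<and> t \<le> c * 3 * max 1 (max_diameter n G)"
    by (intro exI[of _ t]) (simp add: mult.assoc)
qed

end
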